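(* In the formal power series ring $\mathbb{Z}[[v,e,f,t_2,t_3,t_4,\ldots]]$, let $$h(x) = 1 - x + \sum_{k\ge 2} v^{k-1} e^k f\, t_k\, x^k$$ and $$\mathbf{S}_L = \sum_{\mathbf{m}} C[m_2,m_3,\ldots]\,(t_2 v e^2 f)^{m_2}(t_3 v^2 e^3 f)^{m_3}(t_4 v^3 e^4 f)^{m_4}\cdots,$$ where the sum runs over all finitely supported sequences $\mathbf{m}=[m_2,m_3,m_4,\ldots]$ of nonnegative integers and $C[m_2,m_3,\ldots]$ is the hyper-Catalan number. Then for every integer $d\ge 0$, $$h(\mathbf{S}_L \bmod v^{d+1}) \equiv 0 \pmod{v^{d+1}},$$ $$h(\mathbf{S}_L \bmod e^{d+1}) \equiv 0 \pmod{e^{d+1}},$$ $$h(\mathbf{S}_L \bmod f^{d+1}) \equiv 0 \pmod{f^{d+1}}.$$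
   Context: For a finitely supported sequence $\mathbf{m}=[m_2,m_3,m_4,\ldots]$ of nonnegative integers, the hyper-Catalan number is $$C[m_2,m_3,m_4,\ldots] = \frac{(2m_2+3m_3+4m_4+\cdots)!}{(1+m_2+2m_3+3m_4+\cdots)!\; m_2!\, m_3!\, m_4!\cdots}.$$ Equivalently, it is the number of ways of subdividing a planar polygon having one distinguished edge (the roof) by non-crossing diagonals into exactly $m_2$ triangles, $m_3$ quadrilaterals, $m_4$ pentagons, etc., with $C[0,0,\ldots]=1$. The symbols $v,e,f,t_2,t_3,\ldots$ are independent commuting formal variables. $\mathbb{Z}[[v,e,f,t_2,t_3,\ldots]]$ denotes the ring of all formal (possibly infinite) integer combinations of monomials in these countably many variables, each monomial involving only finitely many variables. For an element $a$ of this ring, $h(a)$ denotes $1-a+\sum_{k\ge2} v^{k-1}e^k f\,t_k\,a^k$; the infinite sum is well defined coefficientwise, since any fixed monomial receives contributions from only finitely many $k$. For $z\in\{v,e,f\}$ and an element $a$ of the ring, $a \bmod z^{d+1}$ (as a binary operation) denotes the truncation of $a$ obtained by deleting all terms whose degree in $z$ exceeds $d$. The relation $a\equiv b \pmod{z^{d+1}}$ means that $a-b$ is divisible by $z^{d+1}$, i.e. every monomial occurring in $a-b$ has degree at least $d+1$ in $z$. *)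

theory Defs
  imports Complex_Main "HOL-Library.Poly_Mapping"
begin

abbreviation lookup :: "('i \<Rightarrow>\<^sub>0 'b::zero) \<Rightarrow> 'i \<Rightarrow> 'b" where "lookup \<equiv> Poly_Mapping.lookup"
abbreviation keys :: "('i \<Rightarrow>\<^sub>0 'b::zero) \<Rightarrow> 'i set" where "keys \<equiv> Poly_Mapping.keys"

section \<open>Integer formal power series in arbitrarily many variables\<close>

text \<open>A monomial in variables \<open>'v\<close> is its finitely supported exponent vector \<open>'v \<Rightarrow>\<^sub>0 nat\<close>, and a formal
  power series is an arbitrary family of integer coefficients indexed by the monomials.\<close>

typedef 'v zfps = "UNIV :: (('v \<Rightarrow>\<^sub>0 nat) \<Rightarrow> int) set"
  morphisms coeff Abs_zfps
  by simp

lemma coeff_Abs_zfps [simp]: "coeff (Abs_zfps g) = g"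
  by (simp add: Abs_zfps_inverse)

lemma zfps_eqI: "(\<And>m. coeff a m = coeff b m) \<Longrightarrow> a = b"
  by (metis coeff_inject ext)

lemma zfps_eq_iff: "a = b \<longleftrightarrow> (\<forall>m. coeff a m = coeff b m)"
  using zfps_eqI by auto

definition splits :: "('v \<Rightarrow>\<^sub>0 nat) \<Rightarrow> (('v \<Rightarrow>\<^sub>0 nat) \<times> ('v \<Rightarrow>\<^sub>0 nat)) set" where
  "splits m = {(p, q). p + q = m}"

lemma finite_le_monomial:
  fixes m :: "'v \<Rightarrow>\<^sub>0 nat"
  shows "finite {p :: 'v \<Rightarrow>\<^sub>0 nat. \<forall>x. lookup p x \<le> lookup m x}"
proof -
  let ?B = "\<Union>x\<in>keys m. {..lookup m x}"
  let ?F = "{f. \<forall>x. (x \<in> keys m \<longrightarrow> f x \<in> ?B) \<and> (x \<notin> keys m \<longrightarrow> f x = (0::nat))}"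
  have "finite ?F"
    by (rule finite_set_of_finite_funs) auto
  moreover have "lookup ` {p. \<forall>x. lookup p x \<le> lookup m x} \<subseteq> ?F"
  proof (clarsimp, intro conjI impI)
    fix p :: "'v \<Rightarrow>\<^sub>0 nat" and x
    assume *: "\<forall>x. lookup p x \<le> lookup m x"
    show "\<exists>y\<in>keys m. lookup p x \<le> lookup m y" if "x \<in> keys m"
      using * that by blast
    show "lookup p x = 0" if "x \<notin> keys m"
      using *[rule_format, of x] that by (simp add: in_keys_iff)
  qed
  ultimately have "finite (lookup ` {p. \<forall>x. lookup p x \<le> lookup m x})"
    by (rule finite_subset[rotated])
  then show ?thesis
    by (rule finite_imageD) (auto intro: inj_onI simp: lookup_inject)
qed

lemma finite_splits [simp]: "finite (splits m)"
proof -
  let ?D = "{p. \<forall>x. lookup p x \<le> lookup m x}"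
  have "splits m \<subseteq> ?D \<times> ?D"
    by (auto simp: splits_def lookup_add)
  then show ?thesis
    using finite_le_monomial[of m] by (meson finite_SigmaI finite_subset)
qed

instantiation zfps :: (type) comm_ring_1
begin

definition zero_zfps :: "'a zfps" where "0 = Abs_zfps (\<lambda>_. 0)"
definition one_zfps :: "'a zfps" where "1 = Abs_zfps (\<lambda>m. if m = 0 then 1 else 0)"
definition plus_zfps :: "'a zfps \<Rightarrow> 'a zfps \<Rightarrow> 'a zfps" where
  "a + b = Abs_zfps (\<lambda>m. coeff a m + coeff b m)"
definition minus_zfps :: "'a zfps \<Rightarrow> 'a zfps \<Rightarrow> 'a zfps" where
  "a - b = Abs_zfps (\<lambda>m. coeff a m - coeff b m)"
definition uminus_zfps :: "'a zfps \<Rightarrow> 'a zfps" where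
  "- a = Abs_zfps (\<lambda>m. - coeff a m)"
definition times_zfps :: "'a zfps \<Rightarrow> 'a zfps \<Rightarrow> 'a zfps" where
  "a * b = Abs_zfps (\<lambda>m. \<Sum>(p, q)\<in>splits m. coeff a p * coeff b q)"

instance
proof
  fix a b c :: "'a zfps"
  show "a * b * c = a * (b * c)"
  proof (rule zfps_eqI)
    fix m :: "'a \<Rightarrow>\<^sub>0 nat"
    have "coeff (a * b * c) m =
        (\<Sum>(x, y)\<in>(SIGMA x:splits m. splits (fst x)). coeff a (fst y) * coeff b (snd y) * coeff c (snd x))"
      by (subst sum.Sigma[symmetric])
        (auto simp: times_zfps_def case_prod_unfold sum_distrib_right)
    also have "\<dots> =
        (\<Sum>(x, y)\<in>(SIGMA x:splits m. splits (snd x)). coeff a (fst x) * (coeff b (fst y) * coeff c (snd y)))"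
      by (rule sum.reindex_bij_witness
          [where i = "\<lambda>((p, _), (r, s)). ((p + r, s), (p, r))"
             and j = "\<lambda>((_, q), (r, s)). ((r, s + q), (s, q))"])
        (auto simp: splits_def algebra_simps)
    also have "\<dots> = coeff (a * (b * c)) m"
      by (subst sum.Sigma[symmetric])
        (auto simp: times_zfps_def case_prod_unfold sum_distrib_left)
    finally show "coeff (a * b * c) m = coeff (a * (b * c)) m" .
  qed
  show "a * b = b * a"
    by (rule zfps_eqI, simp add: times_zfps_def,
        rule sum.reindex_bij_witness[where i = prod.swap and j = prod.swap])
      (auto simp: splits_def algebra_simps)
  show "1 * a = a"
  proof (rule zfps_eqI)
    fix m :: "'a \<Rightarrow>\<^sub>0 nat"
    have "coeff (1 * a) m = (\<Sum>(p, q)\<in>{(0, m)}. coeff 1 p * coeff a q)"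
      by (simp only: times_zfps_def coeff_Abs_zfps, rule sum.mono_neutral_right[OF finite_splits])
        (auto simp: splits_def one_zfps_def split: if_splits)
    then show "coeff (1 * a) m = coeff a m"
      by (simp add: one_zfps_def)
  qed
  show "(a + b) * c = a * c + b * c"
    by (rule zfps_eqI)
      (simp add: times_zfps_def plus_zfps_def case_prod_unfold sum.distrib algebra_simps)
  show "(0 :: 'a zfps) \<noteq> 1"
    by (auto simp: zfps_eq_iff zero_zfps_def one_zfps_def)
qed (auto simp: zfps_eq_iff zero_zfps_def plus_zfps_def minus_zfps_def uminus_zfps_def)

end

lemma coeff_zero [simp]: "coeff 0 m = 0"
  and coeff_one: "coeff 1 m = (if m = 0 then 1 else 0)"
  and coeff_add [simp]: "coeff (a + b) m = coeff a m + coeff b m"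
  and coeff_diff [simp]: "coeff (a - b) m = coeff a m - coeff b m"
  and coeff_uminus [simp]: "coeff (- a) m = - coeff a m"
  and coeff_mult: "coeff (a * b) m = (\<Sum>(p, q)\<in>splits m. coeff a p * coeff b q)"
  by (simp_all add: zero_zfps_def one_zfps_def plus_zfps_def minus_zfps_def uminus_zfps_def
      times_zfps_def)

definition indet :: "'v \<Rightarrow> 'v zfps" where
  "indet z = Abs_zfps (\<lambda>m. if m = Poly_Mapping.single z 1 then 1 else 0)"

text \<open>Coefficientwise sum of a possibly infinite family. The value is meaningful only under
  \<open>formally_summable\<close>; otherwise the library convention for sums over infinite sets yields a
  coefficient 0.\<close>

definition formally_summable :: "'i set \<Rightarrow> ('i \<Rightarrow> 'v zfps) \<Rightarrow> bool" where
  "formally_summable I g \<longleftrightarrow> (\<forall>m. finite {i \<in> I. coeff (g i) m \<noteq> 0})"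

definition formal_sum :: "'i set \<Rightarrow> ('i \<Rightarrow> 'v zfps) \<Rightarrow> 'v zfps" where
  "formal_sum I g = Abs_zfps (\<lambda>m. \<Sum>i\<in>{i \<in> I. coeff (g i) m \<noteq> 0}. coeff (g i) m)"

text \<open>\<open>trunc z d a\<close> is \<open>a mod z^(d+1)\<close> as a binary operation.\<close>

definition trunc :: "'v \<Rightarrow> nat \<Rightarrow> 'v zfps \<Rightarrow> 'v zfps" where
  "trunc z d a = Abs_zfps (\<lambda>m. if lookup m z > d then 0 else coeff a m)"

definition cong_mod :: "'v zfps \<Rightarrow> 'v zfps \<Rightarrow> 'v zfps \<Rightarrow> bool" where
  "cong_mod a b c \<longleftrightarrow> c dvd (a - b)"

lemma coeff_indet_mult:
  "coeff (indet z * a) m =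
    (if lookup m z = 0 then 0 else coeff a (m - Poly_Mapping.single z 1))"
proof (cases "lookup m z = 0")
  case True
  have "coeff (indet z * a) m = 0"
    unfolding coeff_mult
  proof (rule sum.neutral, clarsimp)
    fix p q assume "(p, q) \<in> splits m" "coeff a q \<noteq> 0"
    then show "coeff (indet z) p = 0"
      using True by (auto simp: splits_def lookup_add indet_def)
  qed
  with True show ?thesis by simp
next
  case False
  let ?s = "Poly_Mapping.single z (1::nat)"
  have eq: "?s + (m - ?s) = m"
    using False
    by (intro poly_mapping_eqI) (auto simp: lookup_add lookup_minus lookup_single when_def)
  have "coeff (indet z * a) m = (\<Sum>(p, q)\<in>{(?s, m - ?s)}. coeff (indet z) p * coeff a q)"
    unfolding coeff_mult
    by (rule sum.mono_neutral_right[OF finite_splits]) (use eq in \<open>auto simp: splits_def indet_def split: if_splits\<close>)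
  then show ?thesis
    using False by (simp add: indet_def)
qed

lemma coeff_indet_power_mult:
  "coeff (indet z ^ n * a) m =
    (if lookup m z < n then 0 else coeff a (m - Poly_Mapping.single z n))"
proof (induction n arbitrary: a)
  case 0
  then show ?case by simp
next
  case (Suc n)
  have "m - Poly_Mapping.single z n - Poly_Mapping.single z 1 = m - Poly_Mapping.single z (Suc n)"
    by (intro poly_mapping_eqI) (auto simp: lookup_minus lookup_single when_def)
  then show ?case
    using Suc.IH[of "indet z * a"]
    by (auto simp: coeff_indet_mult lookup_minus lookup_single power_commutes mult.assoc[symmetric])
qed

lemma indet_power_dvd_iff:
  "indet z ^ n dvd a \<longleftrightarrow> (\<forall>m. coeff a m \<noteq> 0 \<longrightarrow> n \<le> lookup m z)"
proof
  assume "indet z ^ n dvd a"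
  then show "\<forall>m. coeff a m \<noteq> 0 \<longrightarrow> n \<le> lookup m z"
    by (auto simp: coeff_indet_power_mult split: if_splits elim!: dvdE)
next
  assume *: "\<forall>m. coeff a m \<noteq> 0 \<longrightarrow> n \<le> lookup m z"
  let ?b = "Abs_zfps (\<lambda>m. coeff a (m + Poly_Mapping.single z n))"
  have "a = indet z ^ n * ?b"
  proof (rule zfps_eqI)
    fix m
    show "coeff a m = coeff (indet z ^ n * ?b) m"
    proof (cases "lookup m z < n")
      case True
      with * show ?thesis by (auto simp: coeff_indet_power_mult)
    next
      case False
      then have "m - Poly_Mapping.single z n + Poly_Mapping.single z n = m"
        by (intro poly_mapping_eqI) (auto simp: lookup_add lookup_minus lookup_single when_def)
      with False show ?thesis by (simp add: coeff_indet_power_mult)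
    qed
  qed
  then show "indet z ^ n dvd a" by (rule dvdI)
qed

lemma cong_mod_indet_power_iff:
  "cong_mod a b (indet z ^ n) \<longleftrightarrow> (\<forall>m. coeff (a - b) m \<noteq> 0 \<longrightarrow> n \<le> lookup m z)"
  unfolding cong_mod_def by (rule indet_power_dvd_iff)

section \<open>The ring with variables v, e, f and t_k for k at least 2\<close>

text \<open>\<open>TVar j\<close> stands for \<open>t_(j+2)\<close>, so that there are no superfluous variables
  \<open>t_0\<close> and \<open>t_1\<close>. Accordingly \<open>t k\<close> is meaningful only for \<open>k \<ge> 2\<close>.\<close>

datatype var = VVar | EVar | FVar | TVar nat

definition t :: "nat \<Rightarrow> var zfps" where
  "t k = indet (TVar (k - 2))"

definition h :: "var zfps \<Rightarrow> var zfps" where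
  "h a = 1 - a + formal_sum {2..}
     (\<lambda>k. indet VVar ^ (k - 1) * indet EVar ^ k * indet FVar * t k * a ^ k)"

text \<open>A sequence \<open>[m_2, m_3, \<dots>]\<close> is a finitely supported \<open>m :: nat \<Rightarrow>\<^sub>0 nat\<close> with
  \<open>keys m \<subseteq> {2..}\<close>. The division is exact, see \<open>hyper_catalan_dvd\<close> below.\<close>

definition hyper_catalan :: "(nat \<Rightarrow>\<^sub>0 nat) \<Rightarrow> nat" where
  "hyper_catalan m =
     fact (\<Sum>k\<in>keys m. k * lookup m k) div
     (fact (1 + (\<Sum>k\<in>keys m. (k - 1) * lookup m k)) * (\<Prod>k\<in>keys m. fact (lookup m k)))"

definition S_L :: "var zfps" where
  "S_L = formal_sum {m :: nat \<Rightarrow>\<^sub>0 nat. keys m \<subseteq> {2..}}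
     (\<lambda>m. of_nat (hyper_catalan m) *
        (\<Prod>k\<in>keys m. (t k * indet VVar ^ (k - 1) * indet EVar ^ k * indet FVar) ^ lookup m k))"

lemma prod_fact_dvd_fact_sum:
  "finite A \<Longrightarrow> (\<Prod>i\<in>A. fact (g i)) dvd (fact (\<Sum>i\<in>A. g i) :: nat)"
proof (induction A rule: finite_induct)
  case (insert x A)
  then have "fact (g x) * (\<Prod>i\<in>A. fact (g i)) dvd fact (g x) * (fact (\<Sum>i\<in>A. g i) :: nat)"
    by (intro mult_dvd_mono) auto
  also have "\<dots> dvd fact (g x + (\<Sum>i\<in>A. g i))"
    by (rule fact_fact_dvd_fact)
  finally show ?case using insert by simp
qed simp

lemma hyper_catalan_dvd:
  fixes m :: "nat \<Rightarrow>\<^sub>0 nat"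
  assumes "keys m \<subseteq> {2..}"
  shows "fact (1 + (\<Sum>k\<in>keys m. (k - 1) * lookup m k)) * (\<Prod>k\<in>keys m. fact (lookup m k))
    dvd (fact (\<Sum>k\<in>keys m. k * lookup m k) :: nat)"
proof -
  define P where "P = (\<Sum>k\<in>keys m. (k - 1) * lookup m k)"
  define E where "E = (\<Sum>k\<in>keys m. k * lookup m k)"
  define Q :: nat where "Q = (\<Prod>k\<in>keys m. fact (lookup m k))"
  have E: "E = P + (\<Sum>k\<in>keys m. lookup m k)"
    unfolding E_def P_def sum.distrib[symmetric]
  proof (rule sum.cong[OF refl])
    fix k assume "k \<in> keys m"
    with assms have "k \<ge> 2" by auto
    then obtain j where "k = Suc j" by (cases k) auto
    then show "k * lookup m k = (k - 1) * lookup m k + lookup m k" by simp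
  qed
  have "fact P * Q dvd fact P * (fact (\<Sum>k\<in>keys m. lookup m k) :: nat)"
    unfolding Q_def by (intro mult_dvd_mono prod_fact_dvd_fact_sum) auto
  also have "\<dots> dvd fact E"
    unfolding E by (rule fact_fact_dvd_fact)
  finally have "(1 + P) * (fact P * Q) dvd (1 + P) * fact E"
    by (rule mult_dvd_mono[OF dvd_refl])
  then have 1: "fact (1 + P) * Q dvd (1 + P) * fact E"
    by (simp only: fact_Suc Suc_eq_plus1_left[symmetric] mult.assoc of_nat_id)
  have 2: "fact (1 + P) * Q dvd lookup m k * fact E" if k: "k \<in> keys m" for k
  proof -
    let ?A = "keys m - {k}"
    obtain n where n: "lookup m k = Suc n"
      using k by (cases "lookup m k") (auto simp: in_keys_iff)
    have Q: "Q = (Suc n) * (fact n * (\<Prod>k\<in>?A. fact (lookup m k)))"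
      unfolding Q_def using k n by (subst prod.remove[of _ k]) (auto simp: algebra_simps)
    have s: "E = (1 + P) + (n + (\<Sum>k\<in>?A. lookup m k))"
      unfolding E using k n by (subst sum.remove[of _ k]) auto
    have "fact n * (\<Prod>k\<in>?A. fact (lookup m k)) dvd fact n * (fact (\<Sum>k\<in>?A. lookup m k) :: nat)"
      by (intro mult_dvd_mono prod_fact_dvd_fact_sum) auto
    also have "\<dots> dvd fact (n + (\<Sum>k\<in>?A. lookup m k))"
      by (rule fact_fact_dvd_fact)
    finally have "fact (1 + P) * (fact n * (\<Prod>k\<in>?A. fact (lookup m k)))
        dvd fact (1 + P) * (fact (n + (\<Sum>k\<in>?A. lookup m k)) :: nat)"
      by (rule mult_dvd_mono[OF dvd_refl])
    also have "\<dots> dvd fact E"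
      unfolding s by (rule fact_fact_dvd_fact)
    finally have "Suc n * (fact (1 + P) * (fact n * (\<Prod>k\<in>?A. fact (lookup m k)))) dvd Suc n * fact E"
      by (rule mult_dvd_mono[OF dvd_refl])
    then show ?thesis unfolding Q n by (simp only: mult_ac)
  qed
  have "fact (1 + P) * Q dvd P * fact E"
    unfolding P_def sum_distrib_right mult.assoc
    by (fold P_def) (intro dvd_sum dvd_mult 2)
  with 1 have "fact (1 + P) * Q dvd (1 + P) * fact E - P * fact E"
    by (rule dvd_diff_nat)
  then show ?thesis
    unfolding P_def[symmetric] E_def[symmetric] Q_def[symmetric]
    by (simp add: algebra_simps)
qed

lemma h_summable:
  "formally_summable {2..}
     (\<lambda>k. indet VVar ^ (k - 1) * indet EVar ^ k * indet FVar * t k * a ^ k)"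
  unfolding formally_summable_def
proof
  fix m :: "var \<Rightarrow>\<^sub>0 nat"
  let ?g = "\<lambda>k. indet VVar ^ (k - 1) * indet EVar ^ k * indet FVar * t k * a ^ k"
  have "(\<lambda>k. TVar (k - 2)) ` {k \<in> {2..}. coeff (?g k) m \<noteq> 0} \<subseteq> keys m"
  proof clarify
    fix k assume "coeff (?g k) m \<noteq> 0"
    moreover have "indet (TVar (k - 2)) ^ 1 dvd ?g k"
      unfolding t_def by simp
    ultimately show "TVar (k - 2) \<in> keys m"
      unfolding indet_power_dvd_iff by (fastforce simp: in_keys_iff)
  qed
  then have "finite ((\<lambda>k. TVar (k - 2)) ` {k \<in> {2..}. coeff (?g k) m \<noteq> 0})"
    by (rule finite_subset) simp
  then show "finite {k \<in> {2..}. coeff (?g k) m \<noteq> 0}"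
    by (rule finite_imageD) (auto intro!: inj_onI)
qed

lemma S_L_summable:
  "formally_summable {m :: nat \<Rightarrow>\<^sub>0 nat. keys m \<subseteq> {2..}}
     (\<lambda>m. of_nat (hyper_catalan m) *
        (\<Prod>k\<in>keys m. (t k * indet VVar ^ (k - 1) * indet EVar ^ k * indet FVar) ^ lookup m k))"
  unfolding formally_summable_def
proof
  fix n :: "var \<Rightarrow>\<^sub>0 nat"
  let ?u = "\<lambda>k. t k * indet VVar ^ (k - 1) * indet EVar ^ k * indet FVar"
  let ?g = "\<lambda>m. of_nat (hyper_catalan m) * (\<Prod>k\<in>keys m. ?u k ^ lookup m k)"
  let ?S = "{m \<in> {m :: nat \<Rightarrow>\<^sub>0 nat. keys m \<subseteq> {2..}}. coeff (?g m) n \<noteq> 0}"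
  let ?A = "{k \<in> {2..}. TVar (k - 2) \<in> keys n}"
  have "finite ((\<lambda>k. TVar (k - 2)) ` ?A)"
    by (rule finite_subset[of _ "keys n"]) auto
  then have fin: "finite ?A"
    by (rule finite_imageD) (auto intro!: inj_onI)
  define b where "b = Poly_Mapping.Abs_poly_mapping
    (\<lambda>k. if k \<in> ?A then lookup n (TVar (k - 2)) else 0)"
  have b: "lookup b k = (if k \<in> ?A then lookup n (TVar (k - 2)) else 0)" for k
    unfolding b_def by (subst Abs_poly_mapping_inverse) (auto intro: finite_subset[OF _ fin])
  have "?S \<subseteq> {m. \<forall>k. lookup m k \<le> lookup b k}"
  proof clarify
    fix m :: "nat \<Rightarrow>\<^sub>0 nat" and k
    assume m: "keys m \<subseteq> {2..}" "coeff (?g m) n \<noteq> 0"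
    show "lookup m k \<le> lookup b k"
    proof (cases "k \<in> keys m")
      case False
      then show ?thesis by (simp add: in_keys_iff)
    next
      case True
      have "indet (TVar (k - 2)) ^ lookup m k dvd ?u k ^ lookup m k"
        unfolding t_def by (intro dvd_power_same) (simp add: mult.assoc)
      also have "\<dots> dvd (\<Prod>k\<in>keys m. ?u k ^ lookup m k)"
        using True by (intro dvd_prodI) auto
      also have "\<dots> dvd ?g m" by simp
      finally have "lookup m k \<le> lookup n (TVar (k - 2))"
        using m(2) unfolding indet_power_dvd_iff by blast
      moreover have "lookup m k > 0" using True by (simp add: in_keys_iff)
      ultimately show ?thesis using subsetD[OF m(1) True] by (auto simp: b in_keys_iff)
    qed
  qed
  then show "finite ?S"
    using finite_le_monomial by (rule finite_subset)
qed

end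

theory Submission
  imports Defs
begin

text \<open>The series \<open>S_L\<close> is an exact root of \<open>h\<close>, and truncation replaces it by something congruent. Since \<open>h a\<close>
  is built from powers of \<open>a\<close>, and \<open>a - b\<close> divides \<open>a ^ k - b ^ k\<close>, the function \<open>h\<close> respects
  congruences modulo \<open>z ^ (d + 1)\<close> for every variable \<open>z\<close>; so all three claims follow from
  \<open>h S_L = 0\<close> alone.

  Write \<open>u k = v^(k-1) e^k f t_k\<close>. The equation \<open>h S_L = 0\<close> reads \<open>S_L = 1 + (\<Sum>k\<ge>2. u k * S_L ^ k)\<close>: a plane
  tree is a leaf, or a root with \<open>k\<close> children that carry an ordered forest of \<open>k\<close> trees. The
  powers of \<open>S_L\<close> thus count forests, and the proof determines all of them at once. Let
  \<open>forest_count m r\<close> be the number of ordered forests of \<open>r\<close> plane trees with \<open>m_k\<close> nodes of \<open>k\<close>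
  children in total, for each \<open>k\<close>. Looking at the first tree, which is either a leaf (drop it) or has
  a root with \<open>k\<close> children (remove the root), gives a recursion, used here as the definition. It
  serves two purposes.

  First, induction along it proves the closed form
  \<open>forest_count m r = r (N + r - 1)! / ((P + r)! \<Prod>m_k!)\<close> with \<open>N = \<Sum>k m_k\<close> and \<open>P = \<Sum>(k - 1) m_k\<close>
  (\<open>forest_count_closed_form\<close>); at \<open>r = 1\<close> this is the hyper-Catalan number.

  Second, it says that the generating series \<open>G r\<close> of \<open>forest_count\<close> satisfy
  \<open>G (r + 1) = G r + (\<Sum>k\<ge>2. u k * G (r + k))\<close> (\<open>forest_series_Suc\<close>). This linear system with a given
  \<open>G 0\<close> has only one solution, because every \<open>u k\<close> is divisible by \<open>f\<close>. For fixed \<open>s\<close>, both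
  \<open>G r * G s\<close> and \<open>G (r + s)\<close> solve it with initial value \<open>G s\<close>, so they agree (\<open>forest_series_add\<close>).
  Hence \<open>G r = S_L ^ r\<close>, and the recursion at \<open>r = 0\<close> is the equation \<open>h S_L = 0\<close>.\<close>

section \<open>Formal sums\<close>

lemma formal_sum_cong:
  assumes "\<And>i. i \<in> I \<Longrightarrow> g i = g' i"
  shows "formal_sum I g = formal_sum I g'"
proof (rule zfps_eqI)
  fix m
  have "{i \<in> I. coeff (g i) m \<noteq> 0} = {i \<in> I. coeff (g' i) m \<noteq> 0}"
    using assms by auto
  then show "coeff (formal_sum I g) m = coeff (formal_sum I g') m"
    using assms by (simp add: formal_sum_def)
qed

lemma coeff_formal_sum:
  assumes "finite X" "X \<subseteq> I" "{i \<in> I. coeff (g i) m \<noteq> 0} \<subseteq> X"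
  shows "coeff (formal_sum I g) m = (\<Sum>i\<in>X. coeff (g i) m)"
  unfolding formal_sum_def coeff_Abs_zfps
  by (rule sum.mono_neutral_left) (use assms in auto)

lemma formally_summable_mult_right:
  assumes "formally_summable I g"
  shows "formally_summable I (\<lambda>i. g i * c)"
  unfolding formally_summable_def
proof
  fix m
  let ?X = "\<Union>(p, q)\<in>splits m. {i \<in> I. coeff (g i) p \<noteq> 0}"
  have "finite ?X"
    using assms by (auto simp: formally_summable_def)
  moreover have "{i \<in> I. coeff (g i * c) m \<noteq> 0} \<subseteq> ?X"
    by (fastforce simp: coeff_mult elim!: sum.not_neutral_contains_not_neutral)
  ultimately show "finite {i \<in> I. coeff (g i * c) m \<noteq> 0}"
    by (rule finite_subset[rotated])
qed

lemma formal_sum_mult_right: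
  assumes "formally_summable I g"
  shows "formal_sum I g * c = formal_sum I (\<lambda>i. g i * c)"
proof (rule zfps_eqI)
  fix m
  define X where "X = (\<Union>(p, q)\<in>splits m. {i \<in> I. coeff (g i) p \<noteq> 0})"
  have fin: "finite X"
    using assms by (auto simp: formally_summable_def X_def)
  have sub: "X \<subseteq> I" and supp: "{i \<in> I. coeff (g i * c) m \<noteq> 0} \<subseteq> X"
    by (fastforce simp: X_def coeff_mult elim!: sum.not_neutral_contains_not_neutral)+
  have "coeff (formal_sum I g * c) m =
      (\<Sum>(p, q)\<in>splits m. (\<Sum>i\<in>X. coeff (g i) p) * coeff c q)"
    unfolding coeff_mult
  proof (intro sum.cong refl, clarify)
    fix p q assume "(p, q) \<in> splits m"
    then have "coeff (formal_sum I g) p = (\<Sum>i\<in>X. coeff (g i) p)"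
      by (intro coeff_formal_sum fin sub) (auto simp: X_def)
    then show "coeff (formal_sum I g) p * coeff c q = (\<Sum>i\<in>X. coeff (g i) p) * coeff c q"
      by simp
  qed
  also have "\<dots> = (\<Sum>i\<in>X. coeff (g i * c) m)"
    unfolding coeff_mult case_prod_unfold sum_distrib_right by (rule sum.swap)
  also have "\<dots> = coeff (formal_sum I (\<lambda>i. g i * c)) m"
    by (rule coeff_formal_sum[OF fin sub supp, symmetric])
  finally show "coeff (formal_sum I g * c) m = coeff (formal_sum I (\<lambda>i. g i * c)) m" .
qed

lemma formal_sum_diff:
  assumes "formally_summable I g" "formally_summable I g'"
  shows "formal_sum I g - formal_sum I g' = formal_sum I (\<lambda>i. g i - g' i)"
proof (rule zfps_eqI)
  fix m
  define X where "X = {i \<in> I. coeff (g i) m \<noteq> 0} \<union> {i \<in> I. coeff (g' i) m \<noteq> 0}"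
  have X: "finite X" "X \<subseteq> I"
    using assms by (auto simp: formally_summable_def X_def)
  have "coeff (formal_sum I g) m = (\<Sum>i\<in>X. coeff (g i) m)"
    "coeff (formal_sum I g') m = (\<Sum>i\<in>X. coeff (g' i) m)"
    "coeff (formal_sum I (\<lambda>i. g i - g' i)) m = (\<Sum>i\<in>X. coeff (g i - g' i) m)"
    by (rule coeff_formal_sum; use X in \<open>auto simp: X_def\<close>)+
  then show "coeff (formal_sum I g - formal_sum I g') m = coeff (formal_sum I (\<lambda>i. g i - g' i)) m"
    by (simp add: sum_subtractf)
qed

lemma indet_power_dvd_formal_sum:
  assumes "\<And>i. i \<in> I \<Longrightarrow> indet z ^ n dvd g i"
  shows "indet z ^ n dvd formal_sum I g"
  unfolding indet_power_dvd_iff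
proof (intro allI impI)
  fix m assume "coeff (formal_sum I g) m \<noteq> 0"
  then obtain i where "i \<in> I" "coeff (g i) m \<noteq> 0"
    by (auto simp: formal_sum_def elim!: sum.not_neutral_contains_not_neutral)
  with assms show "n \<le> lookup m z"
    unfolding indet_power_dvd_iff by blast
qed

lemma eq_zero_if_all_indet_powers_dvd:
  assumes "\<And>n. indet z ^ n dvd a"
  shows "a = 0"
proof (rule zfps_eqI)
  fix m show "coeff a m = coeff 0 m"
    using assms[of "Suc (lookup m z)"] unfolding indet_power_dvd_iff by fastforce
qed

section \<open>Monomials\<close>

text \<open>Monomials are indexed by their exponent vector, so that a product of powers of the variables becomes a
  single index, and a coefficient of \<open>monomial w * a\<close> is a coefficient of \<open>a\<close> at a shifted index.\<close>

definition monomial :: "('v \<Rightarrow>\<^sub>0 nat) \<Rightarrow> 'v zfps" where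
  "monomial w = Abs_zfps (\<lambda>n. if n = w then 1 else 0)"

lemma coeff_monomial: "coeff (monomial w) n = (if n = w then 1 else 0)"
  by (simp add: monomial_def)

lemma coeff_monomial_mult_add [simp]: "coeff (monomial w * a) (w + n) = coeff a n"
proof -
  have "coeff (monomial w * a) (w + n) = (\<Sum>(p, q)\<in>{(w, n)}. coeff (monomial w) p * coeff a q)"
    unfolding coeff_mult
    by (rule sum.mono_neutral_right[OF finite_splits])
      (auto simp: splits_def coeff_monomial split: if_splits)
  then show ?thesis by (simp add: coeff_monomial)
qed

lemma coeff_monomial_mult_nonzeroE:
  assumes "coeff (monomial w * a) n \<noteq> 0"
  obtains n' where "n = w + n'" "coeff a n' \<noteq> 0"
proof -
  from assms obtain x where "x \<in> splits n" "coeff (monomial w) (fst x) * coeff a (snd x) \<noteq> 0"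
    by (auto simp: coeff_mult case_prod_unfold elim!: sum.not_neutral_contains_not_neutral)
  then show thesis
    by (intro that[of "snd x"]) (auto simp: splits_def coeff_monomial split: if_splits)
qed

lemma monomial_zero: "monomial 0 = 1"
  by (rule zfps_eqI) (simp add: coeff_monomial coeff_one)

lemma monomial_add: "monomial (w + w') = monomial w * monomial w'"
proof (rule zfps_eqI)
  fix n
  show "coeff (monomial (w + w')) n = coeff (monomial w * monomial w') n"
  proof (cases "\<exists>n'. n = w + n'")
    case True
    then show ?thesis by (auto simp: coeff_monomial)
  next
    case False
    then have "coeff (monomial w * monomial w') n = 0"
      by (auto elim: coeff_monomial_mult_nonzeroE)
    with False show ?thesis by (auto simp: coeff_monomial)
  qed
qed

lemma monomial_sum: "monomial (\<Sum>i\<in>A. w i) = (\<Prod>i\<in>A. monomial (w i))"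
  by (induction A rule: infinite_finite_induct) (simp_all add: monomial_zero monomial_add)

lemma indet_power_eq_monomial: "indet z ^ n = monomial (Poly_Mapping.single z n)"
proof (induction n)
  case (Suc n)
  have "indet z = monomial (Poly_Mapping.single z 1)"
    by (simp add: indet_def monomial_def)
  with Suc show ?case
    by (simp add: monomial_add[symmetric] single_add[symmetric])
qed (simp add: monomial_zero)

section \<open>Counting plane forests by type\<close>

lemma sum_keys_superset:
  fixes f :: "'i \<Rightarrow> nat \<Rightarrow> 'a::comm_monoid_add"
  assumes "finite A" "keys m \<subseteq> A" "\<And>k. f k 0 = 0"
  shows "(\<Sum>k\<in>keys m. f k (lookup m k)) = (\<Sum>k\<in>A. f k (lookup m k))"
  by (rule sum.mono_neutral_left) (use assms in \<open>auto simp: in_keys_iff\<close>)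

text \<open>Adding one node with \<open>k\<close> children to a type \<open>m\<close> changes a statistic of the form
  \<open>\<Sum>j. f j (m_j)\<close> only through its summand at \<open>k\<close>. All of \<open>N\<close>, \<open>P\<close>, the number of nodes and the exponent
  vector of a type are such statistics.\<close>

lemma sum_keys_add_single:
  fixes f :: "'i \<Rightarrow> nat \<Rightarrow> 'a::comm_monoid_add"
  assumes "\<And>k. f k 0 = 0" "\<And>n. f k (Suc n) = f k n + c"
  shows "(\<Sum>j\<in>keys (m + Poly_Mapping.single k 1). f j (lookup (m + Poly_Mapping.single k 1) j))
    = (\<Sum>j\<in>keys m. f j (lookup m j)) + c"
proof -
  let ?A = "insert k (keys m)" and ?m = "m + Poly_Mapping.single k 1"
  have "(\<Sum>j\<in>keys ?m. f j (lookup ?m j)) = (\<Sum>j\<in>?A. f j (lookup ?m j))"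
    by (rule sum_keys_superset) (use assms keys_add[of m "Poly_Mapping.single k 1"] in auto)
  also have "\<dots> = f k (lookup ?m k) + (\<Sum>j\<in>?A - {k}. f j (lookup ?m j))"
    by (rule sum.remove) auto
  also have "(\<Sum>j\<in>?A - {k}. f j (lookup ?m j)) = (\<Sum>j\<in>?A - {k}. f j (lookup m j))"
    by (rule sum.cong) (auto simp: lookup_add lookup_single)
  also have "f k (lookup ?m k) = f k (lookup m k) + c"
    by (simp add: lookup_add assms)
  also have "f k (lookup m k) + c + (\<Sum>j\<in>?A - {k}. f j (lookup m j))
      = (f k (lookup m k) + (\<Sum>j\<in>?A - {k}. f j (lookup m j))) + c"
    by (simp add: ac_simps)
  also have "f k (lookup m k) + (\<Sum>j\<in>?A - {k}. f j (lookup m j)) = (\<Sum>j\<in>?A. f j (lookup m j))"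
    by (rule sum.remove[symmetric]) auto
  also have "\<dots> = (\<Sum>j\<in>keys m. f j (lookup m j))"
    by (rule sum_keys_superset[symmetric]) (use assms in auto)
  finally show ?thesis .
qed

lemma prod_fact_keys_add_single:
  fixes m :: "'i \<Rightarrow>\<^sub>0 nat" and k :: 'i
  defines "m' \<equiv> m + Poly_Mapping.single k 1"
  shows "(\<Prod>j\<in>keys m'. fact (lookup m' j)) =
    lookup m' k * (\<Prod>j\<in>keys m. fact (lookup m j) :: nat)"
proof -
  let ?A = "insert k (keys m)"
  have superset: "(\<Prod>j\<in>keys n. fact (lookup n j) :: nat) = (\<Prod>j\<in>?A. fact (lookup n j))"
    if "keys n \<subseteq> ?A" for n
    by (rule prod.mono_neutral_left) (use that in \<open>auto simp: in_keys_iff\<close>)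
  have "(\<Prod>j\<in>keys m'. fact (lookup m' j) :: nat) = (\<Prod>j\<in>?A. fact (lookup m' j))"
    by (rule superset) (use keys_add[of m "Poly_Mapping.single k 1"] in \<open>auto simp: m'_def\<close>)
  also have "\<dots> = fact (lookup m' k) * (\<Prod>j\<in>?A - {k}. fact (lookup m' j))"
    by (rule prod.remove) auto
  also have "(\<Prod>j\<in>?A - {k}. fact (lookup m' j) :: nat) = (\<Prod>j\<in>?A - {k}. fact (lookup m j))"
    by (rule prod.cong) (auto simp: m'_def lookup_add lookup_single)
  also have "fact (lookup m' k) = lookup m' k * (fact (lookup m k) :: nat)"
    by (simp add: m'_def lookup_add)
  also have "lookup m' k * fact (lookup m k) * (\<Prod>j\<in>?A - {k}. fact (lookup m j) :: nat)
      = lookup m' k * (\<Prod>j\<in>?A. fact (lookup m j))"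
    by (subst (2) prod.remove[of _ k]) auto
  also have "(\<Prod>j\<in>?A. fact (lookup m j) :: nat) = (\<Prod>j\<in>keys m. fact (lookup m j))"
    by (rule superset[symmetric]) auto
  finally show ?thesis .
qed

lemma minus_single_add_single:
  fixes m :: "'i \<Rightarrow>\<^sub>0 nat"
  assumes "k \<in> keys m"
  shows "(m - Poly_Mapping.single k 1) + Poly_Mapping.single k 1 = m"
  using assms
  by (intro poly_mapping_eqI) (auto simp: lookup_add lookup_minus lookup_single when_def in_keys_iff)

text \<open>The number of ordered forests of \<open>r\<close> plane trees that have, for each \<open>k\<close>, exactly \<open>m_k\<close> nodes with \<open>k\<close>
  children, leaves not being recorded in \<open>m\<close>. In the recursive case the first tree is a leaf, which
  is dropped, or its root is removed and its \<open>k\<close> subtrees are put in front of the remaining \<open>r\<close> trees.\<close>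

function forest_count :: "(nat \<Rightarrow>\<^sub>0 nat) \<Rightarrow> nat \<Rightarrow> nat" where
  "forest_count m 0 = (if m = 0 then 1 else 0)"
| "forest_count m (Suc r) = forest_count m r +
     (\<Sum>k\<in>keys m. forest_count (m - Poly_Mapping.single k 1) (r + k))"
  by pat_completeness auto
termination
proof (relation "measures [\<lambda>(m, r). \<Sum>k\<in>keys m. lookup m k, snd]", goal_cases)
  case (3 m r k)
  with sum_keys_add_single[of "\<lambda>_ n. n" k 1 "m - Poly_Mapping.single k 1"]
  show ?case by (simp add: minus_single_add_single del: One_nat_def)
qed auto

text \<open>Stated without division: the left factors are the denominator of the closed form. The pair
  \<open>m = 0\<close>, \<open>r = 0\<close> is excluded because there the closed form is \<open>0 * (-1)!\<close>, which natural
  number subtraction would turn into 0, whereas the empty forest counts 1.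

  Let \<open>m\<close> be nonzero and let \<open>F = N - P\<close> be its number of nodes. After multiplication by
  \<open>(P + r + 1)! \<Prod>m_k!\<close>, the forests that start with a leaf contribute \<open>r (P + r + 1) (N + r - 1)!\<close> to the recursion for \<open>r + 1\<close>, and those that start with a
  node of \<open>k\<close> children contribute \<open>m_k (r + k) (N + r - 1)!\<close>, which sums to \<open>(r F + N) (N + r - 1)!\<close>.
  The total is \<open>(r + 1) (N + r)!\<close>, as \<open>r (P + r + 1 + F) + N = (r + 1) (N + r)\<close>.\<close>

lemma forest_count_closed_form:
  assumes "keys m \<subseteq> {2..}" "m \<noteq> 0 \<or> r \<noteq> 0"
  shows "fact ((\<Sum>k\<in>keys m. (k - 1) * lookup m k) + r) * (\<Prod>k\<in>keys m. fact (lookup m k)) *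
      forest_count m r = r * (fact ((\<Sum>k\<in>keys m. k * lookup m k) + r - 1) :: nat)"
  using assms
proof (induction m r rule: forest_count.induct)
  case (1 m)
  then show ?case by simp
next
  case (2 m r)
  show ?case
  proof (cases "m = 0")
    case True
    have "forest_count 0 n = 1" for n by (induction n) auto
    with True show ?thesis by simp
  next
    case False
    \<comment> \<open>\<open>N'\<close> below is \<open>N - 1\<close>, which keeps truncated subtraction out of the factorials.\<close>
    define P where "P = (\<Sum>k\<in>keys m. (k - 1) * lookup m k)"
    define N where "N = (\<Sum>k\<in>keys m. k * lookup m k)"
    define F where "F = (\<Sum>k\<in>keys m. lookup m k)"
    define M where "M = (\<Prod>k\<in>keys m. fact (lookup m k) :: nat)"
    have N: "N = P + F"
      unfolding N_def P_def F_def sum.distrib[symmetric]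
    proof (rule sum.cong[OF refl])
      fix k assume "k \<in> keys m"
      with 2(3) have "k \<ge> 2" by auto
      then obtain j where "k = Suc j" by (cases k) auto
      then show "k * lookup m k = (k - 1) * lookup m k + lookup m k" by simp
    qed
    have "keys m \<noteq> {}" using False by simp
    then have "F \<noteq> 0" by (fastforce simp: F_def in_keys_iff)
    then have "N \<noteq> 0" using N by simp
    then obtain N' where N': "N = Suc N'" by (cases N) auto
    have IH: "fact (P + r) * M * forest_count m r = r * fact (N' + r)"
      using 2(1)[OF 2(3)] False N' unfolding P_def[symmetric] N_def[symmetric] M_def[symmetric]
      by simp
    have child: "fact (P + Suc r) * M * forest_count (m - Poly_Mapping.single k 1) (r + k)
        = lookup m k * (r + k) * fact (N' + r)" if k: "k \<in> keys m" for k
    proof -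
      define m' where "m' = m - Poly_Mapping.single k 1"
      have m: "m = m' + Poly_Mapping.single k 1"
        unfolding m'_def using minus_single_add_single[OF k] by simp
      have k2: "k \<ge> 2" using 2(3) k by auto
      have "keys m' \<subseteq> keys m" by (auto simp: m'_def in_keys_iff lookup_minus)
      with 2(3) have k': "keys m' \<subseteq> {2..}" by blast
      have P: "P = (\<Sum>j\<in>keys m'. (j - 1) * lookup m' j) + (k - 1)"
        unfolding P_def m by (rule sum_keys_add_single) auto
      have N1: "N = (\<Sum>j\<in>keys m'. j * lookup m' j) + k"
        unfolding N_def m by (rule sum_keys_add_single) auto
      have M: "M = lookup m k * (\<Prod>j\<in>keys m'. fact (lookup m' j))"
        unfolding M_def m by (rule prod_fact_keys_add_single)
      have e1: "(\<Sum>j\<in>keys m'. (j - 1) * lookup m' j) + (r + k) = P + Suc r"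
        using P k2 by simp
      have e2: "(\<Sum>j\<in>keys m'. j * lookup m' j) + (r + k) - 1 = N' + r"
        using N1 N' by simp
      have "fact (P + Suc r) * (\<Prod>j\<in>keys m'. fact (lookup m' j)) * forest_count m' (r + k)
          = (r + k) * fact (N' + r)"
        using 2(2)[OF k] k2 k' unfolding m'_def[symmetric] e1 e2 by simp
      then show ?thesis
        unfolding M m'_def[symmetric] by (metis mult.assoc mult.left_commute)
    qed
    have "fact (P + Suc r) * M * forest_count m (Suc r) = fact (P + Suc r) * M * forest_count m r +
        (\<Sum>k\<in>keys m. fact (P + Suc r) * M * forest_count (m - Poly_Mapping.single k 1) (r + k))"
      by (simp only: forest_count.simps distrib_left sum_distrib_left)
    also have "fact (P + Suc r) * M * forest_count m r
        = (P + Suc r) * (fact (P + r) * M * forest_count m r)"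
      by (simp add: algebra_simps)
    also have "(\<Sum>k\<in>keys m. fact (P + Suc r) * M * forest_count (m - Poly_Mapping.single k 1) (r + k))
        = (\<Sum>k\<in>keys m. (r * lookup m k + k * lookup m k) * fact (N' + r))"
      by (rule sum.cong[OF refl]) (simp only: child, simp add: algebra_simps)
    also have "\<dots> = (r * F + N) * fact (N' + r)"
      by (simp only: F_def N_def sum_distrib_right[symmetric] sum.distrib sum_distrib_left)
    also have "(P + Suc r) * (fact (P + r) * M * forest_count m r) + (r * F + N) * fact (N' + r)
        = (r * (P + F + r + 1) + N) * fact (N' + r)"
      unfolding IH by (simp add: algebra_simps)
    also have "r * (P + F + r + 1) + N = Suc r * Suc (N' + r)"
      unfolding N[symmetric] N' by (simp add: algebra_simps)
    also have "Suc r * Suc (N' + r) * fact (N' + r) = Suc r * fact (N + Suc r - 1)"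
      by (simp add: N' algebra_simps)
    finally show ?thesis
      unfolding P_def[symmetric] N_def[symmetric] M_def[symmetric] .
  qed
qed

lemma hyper_catalan_eq_forest_count:
  assumes "keys m \<subseteq> {2..}"
  shows "hyper_catalan m = forest_count m 1"
proof -
  let ?D = "fact (1 + (\<Sum>k\<in>keys m. (k - 1) * lookup m k)) * (\<Prod>k\<in>keys m. fact (lookup m k)) :: nat"
  have "fact (\<Sum>k\<in>keys m. k * lookup m k) = ?D * forest_count m 1"
    using forest_count_closed_form[OF assms, of 1] by (simp add: add.commute)
  moreover have "?D \<noteq> 0" by simp
  ultimately show ?thesis
    unfolding hyper_catalan_def by (metis nonzero_mult_div_cancel_left)
qed

section \<open>The generating series of forests\<close>

definition node_exp :: "nat \<Rightarrow> var \<Rightarrow>\<^sub>0 nat" where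
  "node_exp k = Poly_Mapping.single VVar (k - 1) + Poly_Mapping.single EVar k +
     Poly_Mapping.single FVar 1 + Poly_Mapping.single (TVar (k - 2)) 1"

text \<open>The multiple of \<open>node_exp k\<close> by \<open>m_k\<close> is written as repeated addition, so that \<open>monomial_sum\<close> turns
  it directly into the power of \<open>u k\<close> that occurs in \<open>S_L\<close>.\<close>

definition forest_exp :: "(nat \<Rightarrow>\<^sub>0 nat) \<Rightarrow> var \<Rightarrow>\<^sub>0 nat" where
  "forest_exp m = (\<Sum>k\<in>keys m. \<Sum>i<lookup m k. node_exp k)"

definition forest_series :: "nat \<Rightarrow> var zfps" where
  "forest_series r = formal_sum {m. keys m \<subseteq> {2..}}
     (\<lambda>m. of_nat (forest_count m r) * monomial (forest_exp m))"

lemma monomial_node_exp: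
  "monomial (node_exp k) = indet VVar ^ (k - 1) * indet EVar ^ k * indet FVar * t k"
  using indet_power_eq_monomial[of FVar 1] indet_power_eq_monomial[of "TVar (k - 2)" 1]
  by (simp add: node_exp_def monomial_add indet_power_eq_monomial t_def)

lemma h_eq: "h a = 1 - a + formal_sum {2..} (\<lambda>k. monomial (node_exp k) * a ^ k)"
  by (simp add: h_def monomial_node_exp)

text \<open>A monomial that occurs in the \<open>k\<close>-th summand contains the variable \<open>t_k\<close>, and it contains only
  finitely many variables.\<close>

lemma node_summable: "formally_summable {2..} (\<lambda>k. monomial (node_exp k) * a k)"
  unfolding formally_summable_def
proof
  fix n :: "var \<Rightarrow>\<^sub>0 nat"
  have "(\<lambda>k. TVar (k - 2)) ` {k \<in> {2..}. coeff (monomial (node_exp k) * a k) n \<noteq> 0} \<subseteq> keys n"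
    by (auto elim!: coeff_monomial_mult_nonzeroE simp: in_keys_iff lookup_add node_exp_def)
  then have "finite ((\<lambda>k. TVar (k - 2)) ` {k \<in> {2..}. coeff (monomial (node_exp k) * a k) n \<noteq> 0})"
    by (rule finite_subset) simp
  then show "finite {k \<in> {2..}. coeff (monomial (node_exp k) * a k) n \<noteq> 0}"
    by (rule finite_imageD) (auto intro!: inj_onI)
qed

lemma forest_exp_add_single:
  "forest_exp (m + Poly_Mapping.single k 1) = forest_exp m + node_exp k"
  unfolding forest_exp_def by (rule sum_keys_add_single) auto

lemma lookup_forest_exp_TVar:
  assumes "keys m \<subseteq> {2..}" "k \<ge> 2"
  shows "lookup (forest_exp m) (TVar (k - 2)) = lookup m k"
proof -
  have "lookup (forest_exp m) (TVar (k - 2)) = (\<Sum>j\<in>keys m. if j = k then lookup m j else 0)"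
    unfolding forest_exp_def lookup_sum
  proof (rule sum.cong[OF refl])
    fix j assume "j \<in> keys m"
    with assms have "j \<ge> 2" by auto
    then show "(\<Sum>i<lookup m j. lookup (node_exp j) (TVar (k - 2))) = (if j = k then lookup m j else 0)"
      using assms(2) by (auto simp: node_exp_def lookup_add lookup_single when_def)
  qed
  then show ?thesis by (simp add: in_keys_iff)
qed

text \<open>The exponents of the variables \<open>t_k\<close> alone recover the type, so distinct types never contribute to the same
  monomial, and every coefficient of a forest series is a single count.\<close>

lemma inj_on_forest_exp: "inj_on forest_exp {m. keys m \<subseteq> {2..}}"
proof (rule inj_onI, clarify)
  fix m m' :: "nat \<Rightarrow>\<^sub>0 nat"
  assume *: "keys m \<subseteq> {2..}" "keys m' \<subseteq> {2..}" "forest_exp m = forest_exp m'"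
  show "m = m'"
  proof (rule poly_mapping_eqI)
    fix k show "lookup m k = lookup m' k"
    proof (cases "k \<ge> 2")
      case True
      with * lookup_forest_exp_TVar show ?thesis by metis
    next
      case False
      with * have "k \<notin> keys m" "k \<notin> keys m'" by auto
      then show ?thesis by (simp add: in_keys_iff)
    qed
  qed
qed

lemma coeff_of_nat_mult: "coeff (of_nat c * a) m = int c * coeff a m"
  by (induction c) (simp_all add: algebra_simps)

lemma coeff_forest_series [simp]:
  assumes "keys m \<subseteq> {2..}"
  shows "coeff (forest_series r) (forest_exp m) = int (forest_count m r)"
proof -
  have "coeff (forest_series r) (forest_exp m) = (\<Sum>m\<in>{m}.
      coeff (of_nat (forest_count m r) * monomial (forest_exp m)) (forest_exp m))"
    unfolding forest_series_def
  proof (rule trans[OF coeff_formal_sum[of "{m}"]])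
    show "{i \<in> {m. keys m \<subseteq> {2..}}. coeff (of_nat (forest_count i r) *
        monomial (forest_exp i)) (forest_exp m) \<noteq> 0} \<subseteq> {m}"
      using assms inj_onD[OF inj_on_forest_exp]
      by (auto simp: coeff_of_nat_mult coeff_monomial split: if_splits)
  qed (use assms in auto)
  then show ?thesis by (simp add: coeff_of_nat_mult coeff_monomial)
qed

lemma coeff_forest_series_nonzeroE:
  assumes "coeff (forest_series r) n \<noteq> 0"
  obtains m where "keys m \<subseteq> {2..}" "n = forest_exp m"
  using assms unfolding forest_series_def formal_sum_def
  by (auto simp: coeff_of_nat_mult coeff_monomial
      elim!: sum.not_neutral_contains_not_neutral split: if_splits)

lemma S_L_eq_forest_series: "S_L = forest_series 1"
proof -
  have "monomial (forest_exp m) =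
      (\<Prod>k\<in>keys m. (t k * indet VVar ^ (k - 1) * indet EVar ^ k * indet FVar) ^ lookup m k)" for m
    by (simp add: forest_exp_def monomial_sum monomial_node_exp ac_simps)
  then show ?thesis
    unfolding S_L_def forest_series_def
    by (intro formal_sum_cong) (simp add: hyper_catalan_eq_forest_count del: forest_count.simps One_nat_def)
qed

lemma forest_series_0: "forest_series 0 = 1"
proof (rule zfps_eqI)
  fix n
  have [simp]: "forest_exp 0 = 0" by (simp add: forest_exp_def)
  show "coeff (forest_series 0) n = coeff 1 n"
  proof (cases "\<exists>m. keys m \<subseteq> {2..} \<and> n = forest_exp m")
    case True
    then obtain m where m: "keys m \<subseteq> {2..}" "n = forest_exp m" by blast
    then have "n = 0 \<longleftrightarrow> m = 0"
      using inj_onD[OF inj_on_forest_exp, of m 0] by auto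
    with m show ?thesis by (simp add: coeff_one)
  next
    case False
    then have "n \<noteq> 0" by (metis \<open>forest_exp 0 = 0\<close> empty_subsetI keys_zero)
    moreover have "coeff (forest_series 0) n = 0"
      using False by (blast elim: coeff_forest_series_nonzeroE)
    ultimately show ?thesis by (simp add: coeff_one)
  qed
qed

text \<open>Coefficientwise this is the recursion of \<open>forest_count\<close>. The only point to check is that \<open>u k\<close> divides
  the monomial of a type \<open>m\<close> exactly when \<open>m\<close> has a node with \<open>k\<close> children, the quotient being the
  monomial of \<open>m\<close> with that node removed, and that multiplying by \<open>u k\<close> always leads from monomials of
  types to monomials of types.\<close>

lemma forest_series_Suc:
  "forest_series (Suc r) = forest_series r +
     formal_sum {2..} (\<lambda>k. monomial (node_exp k) * forest_series (r + k))"
proof (rule zfps_eqI)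
  fix n
  let ?g = "\<lambda>k. monomial (node_exp k) * forest_series (r + k)"
  have "coeff (forest_series (Suc r)) n = coeff (forest_series r) n + coeff (formal_sum {2..} ?g) n"
  proof (cases "\<exists>m. keys m \<subseteq> {2..} \<and> n = forest_exp m")
    case True
    then obtain m where m: "keys m \<subseteq> {2..}" "n = forest_exp m" by blast
    have "coeff (formal_sum {2..} ?g) n = (\<Sum>k\<in>keys m. coeff (?g k) n)"
    proof (rule coeff_formal_sum)
      show "{k \<in> {2..}. coeff (?g k) n \<noteq> 0} \<subseteq> keys m"
      proof clarify
        fix k :: nat assume k: "k \<ge> 2" "coeff (?g k) n \<noteq> 0"
        then have "lookup n (TVar (k - 2)) \<noteq> 0"
          by (auto elim!: coeff_monomial_mult_nonzeroE simp: lookup_add node_exp_def)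
        then show "k \<in> keys m"
          using k m by (simp add: lookup_forest_exp_TVar in_keys_iff)
      qed
    qed (use m in auto)
    also have "\<dots> = (\<Sum>k\<in>keys m. int (forest_count (m - Poly_Mapping.single k 1) (r + k)))"
    proof (rule sum.cong[OF refl])
      fix k assume k: "k \<in> keys m"
      let ?m = "m - Poly_Mapping.single k 1"
      have "n = node_exp k + forest_exp ?m"
        using forest_exp_add_single[of ?m k] minus_single_add_single[OF k] m
        by (simp add: add.commute)
      moreover have "keys ?m \<subseteq> keys m"
        by (auto simp: in_keys_iff lookup_minus)
      then have "keys ?m \<subseteq> {2..}"
        using m by blast
      ultimately show "coeff (?g k) n = int (forest_count ?m (r + k))" by simp
    qed
    finally show ?thesis using m by simp
  next
    case False
    have "coeff (forest_series s) n = 0" for s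
      using False by (blast elim: coeff_forest_series_nonzeroE)
    moreover have "coeff (?g k) n = 0" if "k \<ge> 2" for k
    proof (rule ccontr)
      assume "coeff (?g k) n \<noteq> 0"
      then obtain m where m: "keys m \<subseteq> {2..}" "n = node_exp k + forest_exp m"
        by (metis coeff_monomial_mult_nonzeroE coeff_forest_series_nonzeroE)
      then have "n = forest_exp (m + Poly_Mapping.single k 1)"
        by (simp only: forest_exp_add_single add.commute)
      moreover have "keys (m + Poly_Mapping.single k 1) \<subseteq> {2..}"
        using m \<open>k \<ge> 2\<close> keys_add[of m "Poly_Mapping.single k 1"] by auto
      ultimately show False using False by blast
    qed
    ultimately show ?thesis by (simp add: formal_sum_def)
  qed
  then show "coeff (forest_series (Suc r)) n = coeff (forest_series r + formal_sum {2..} ?g) n"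
    by simp
qed

text \<open>The difference \<open>D r\<close> of the two sides solves the homogeneous system
  \<open>D (r + 1) = D r + (\<Sum>k\<ge>2. u k * D (r + k))\<close> with \<open>D 0 = 0\<close>. If \<open>f ^ n\<close> divides every \<open>D r\<close>, then the
  sum is divisible by \<open>f ^ (n + 1)\<close>, because each \<open>u k\<close> contains \<open>f\<close>; induction on \<open>r\<close> then makes
  every \<open>D r\<close> divisible by \<open>f ^ (n + 1)\<close>. So \<open>D\<close> vanishes. The number of trees \<open>r + k\<close> on the
  right exceeds \<open>r + 1\<close>, which is why the outer induction has to be on the power of \<open>f\<close>.\<close>

lemma forest_series_add: "forest_series (r + s) = forest_series r * forest_series s"
proof -
  define D where "D = (\<lambda>r. forest_series r * forest_series s - forest_series (r + s))"
  have D_Suc: "D (Suc r) = D r + formal_sum {2..} (\<lambda>k. monomial (node_exp k) * D (r + k))" for r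
  proof -
    let ?A = "\<lambda>k. monomial (node_exp k) * forest_series (r + k)"
    let ?B = "\<lambda>k. monomial (node_exp k) * forest_series (r + s + k)"
    have "D (Suc r) = D r + (formal_sum {2..} ?A * forest_series s - formal_sum {2..} ?B)"
      by (simp add: D_def forest_series_Suc algebra_simps)
    also have "formal_sum {2..} ?A * forest_series s - formal_sum {2..} ?B
        = formal_sum {2..} (\<lambda>k. ?A k * forest_series s - ?B k)"
      by (simp only: formal_sum_mult_right[OF node_summable]
          formal_sum_diff[OF formally_summable_mult_right[OF node_summable] node_summable])
    also have "(\<lambda>k. ?A k * forest_series s - ?B k) = (\<lambda>k. monomial (node_exp k) * D (r + k))"
      by (simp add: D_def fun_eq_iff algebra_simps)
    finally show ?thesis .
  qed
  have "indet FVar ^ n dvd D r" for n r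
  proof (induction n arbitrary: r)
    case (Suc n)
    show ?case
    proof (induction r)
      case 0
      show ?case by (simp add: D_def forest_series_0)
    next
      case (Suc r)
      have "indet FVar dvd monomial (node_exp k)" for k
        by (simp add: monomial_node_exp)
      then have "indet FVar ^ Suc n dvd monomial (node_exp k) * D (r + k)" for k
        unfolding power_Suc using \<open>\<And>r. indet FVar ^ n dvd D r\<close> by (rule mult_dvd_mono)
      with Suc.IH show ?case
        unfolding D_Suc by (intro dvd_add indet_power_dvd_formal_sum)
    qed
  qed simp
  then have "D r = 0"
    by (rule eq_zero_if_all_indet_powers_dvd)
  then show ?thesis by (simp add: D_def)
qed

lemma forest_series_eq_power: "forest_series r = forest_series 1 ^ r"
proof (induction r)
  case (Suc r)
  have "forest_series (Suc r) = forest_series r * forest_series 1"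
    using forest_series_add[of r 1] by simp
  with Suc show ?case by (simp add: mult.commute)
qed (simp add: forest_series_0)

lemma h_S_L_eq_0: "h S_L = 0"
proof -
  have "forest_series 1 = 1 + formal_sum {2..} (\<lambda>k. monomial (node_exp k) * forest_series 1 ^ k)"
  proof -
    have *: "(\<lambda>k. monomial (node_exp k) * forest_series (0 + k))
        = (\<lambda>k. monomial (node_exp k) * forest_series 1 ^ k)"
      by (rule ext) (metis add_0 forest_series_eq_power)
    show ?thesis
      using forest_series_Suc[of 0] unfolding * forest_series_0 One_nat_def .
  qed
  then have "formal_sum {2..} (\<lambda>k. monomial (node_exp k) * forest_series 1 ^ k) = forest_series 1 - 1"
    by (metis add_diff_cancel_left')
  then show ?thesis
    by (simp add: h_eq S_L_eq_forest_series del: One_nat_def)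
qed

section \<open>Truncation\<close>

text \<open>Congruent arguments give congruent values, term by term, because \<open>a - b\<close> divides \<open>a ^ k - b ^ k\<close>.\<close>

lemma indet_power_dvd_h_diff:
  assumes "indet z ^ n dvd a - b"
  shows "indet z ^ n dvd h a - h b"
proof -
  have "h a - h b = - (a - b) +
      formal_sum {2..} (\<lambda>k. monomial (node_exp k) * a ^ k - monomial (node_exp k) * b ^ k)"
    unfolding h_eq formal_sum_diff[OF node_summable node_summable, symmetric]
    by (simp add: algebra_simps)
  moreover have "indet z ^ n dvd monomial (node_exp k) * a ^ k - monomial (node_exp k) * b ^ k" for k
  proof -
    have "a - b dvd a ^ k - b ^ k"
      by (subst power_diff_sumr2) simp
    with assms have "indet z ^ n dvd a ^ k - b ^ k"
      by (rule dvd_trans)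
    then show ?thesis
      unfolding right_diff_distrib[symmetric] by (rule dvd_mult)
  qed
  moreover have "indet z ^ n dvd - (a - b)"
    using assms by (simp only: dvd_minus_iff)
  ultimately show ?thesis
    by (simp only: dvd_add indet_power_dvd_formal_sum)
qed

lemma indet_power_dvd_trunc_diff: "indet z ^ (d + 1) dvd trunc z d a - a"
  unfolding indet_power_dvd_iff by (auto simp: trunc_def split: if_splits)

lemma h_trunc_root_cong:
  assumes "h a = 0"
  shows "cong_mod (h (trunc z d a)) 0 (indet z ^ (d + 1))"
  using indet_power_dvd_h_diff[OF indet_power_dvd_trunc_diff[of z d a]] assms
  by (simp add: cong_mod_def)

theorem theorem4:
  fixes d :: nat
  shows "cong_mod (h (trunc VVar d S_L)) 0 (indet VVar ^ (d + 1))
       \<and> cong_mod (h (trunc EVar d S_L)) 0 (indet EVar ^ (d + 1))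
       \<and> cong_mod (h (trunc FVar d S_L)) 0 (indet FVar ^ (d + 1))"
  by (intro conjI h_trunc_root_cong h_S_L_eq_0)

end
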